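(* Let $X$ be a finite $T_0$-space and let $A$ be a bp-retract of $X$. Let $r\colon X\to A$ be the corresponding retraction and let $i\colon A \to X$ be the inclusion map. (a) If $\mathrm{mnl}(X)\subseteq A$, then $\mathcal{F}(r)(C)=r(C)$ for all $C\in\mathcal{F}(X)$ and $\mathcal{F}(r)\,\mathcal{F}(i)=\mathrm{id}_{\mathcal{F}(A)}$. (b) If $A$ is a dbp-retract of $X$, then $\mathcal{F}(r)$ is a homeomorphism. (c) If $\mathrm{mnl}(X)\subseteq A$ and $A$ is a ubp-retract of $X$, then $\mathcal{F}(i)\,\mathcal{F}(r)\geq \mathrm{id}_{\mathcal{F}(X)}$.
   Context: A finite $T_0$-space is identified with a finite poset: $x\le y$ iff $U_x\subseteq U_y$, where $U_x=\{z\mid z\le x\}$ is the minimal open set containing $x$; $F_x=\{z\mid z\ge x\}$ is the smallest closed set containing $x$. Open sets are the down-sets, and continuous maps are the order-preserving maps; maps into a poset are compared pointwise. Let $\widehat U_x=U_x-\{x\}$ and $\widehat F_x=F_x-\{x\}$. A point $x\in X$ is a down beat point of $X$ if $\widehat U_x$ has a maximum, and an up beat point of $X$ if $\widehat F_x$ has a minimum. A subspace $A\subseteq X$ is a dbp-retract (resp. ubp-retract) of $X$ if $A$ can be obtained from $X$ by successively removing down beat points (resp. up beat points), one at a time, each being a down (resp. up) beat point of the subspace obtained at that stage (zero removals allowed). $A$ is a bp-retract of $X$ if it is a dbp-retract or a ubp-retract of $X$. With $i\colon A\to X$ the inclusion, the corresponding retraction is the unique continuous $r\colon X\to A$ with $ri=\mathrm{id}_A$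 and $ir\le \mathrm{id}_X$ if $A$ is a dbp-retract (resp. $ir\ge\mathrm{id}_X$ if $A$ is a ubp-retract). $\mathrm{mnl}(X)$ is the set of minimal elements of $X$. For a non-empty subset $B\subseteq X$ let $F_B=\bigcap_{b\in B}F_b$. $\mathcal{F}(X)$ is the set of all connected components of the non-empty sets $F_B$ with $\varnothing\ne B\subseteq \mathrm{mnl}(X)$, regarded as a poset (finite $T_0$-space) ordered by reverse inclusion: $C_1\le C_2$ iff $C_1\supseteq C_2$. For a continuous map $f\colon X\to Y$ of finite $T_0$-spaces, $\mathcal{F}(f)\colon\mathcal{F}(X)\to\mathcal{F}(Y)$ is the continuous map $\mathcal{F}(f)(C)=\max\{D\in\mathcal{F}(Y)\mid f(C)\subseteq D\}$ (maximum in the poset $\mathcal{F}(Y)$, i.e. the smallest such $D$ for inclusion; it exists). *)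

theory Defs
  imports "HOL-Analysis.Analysis"
begin

text \<open>
  Finite \<open>T\<^sub>0\<close>-spaces are rendered as abstract topologies \<open>X\<close> with \<^term>\<open>finite (topspace X)\<close> and
  \<^term>\<open>t0_space X\<close>; the associated partial order is derived from the topology, and subspaces are
  \<^term>\<open>subtopology X A\<close>.
\<close>

definition min_open :: "'a topology \<Rightarrow> 'a \<Rightarrow> 'a set" where
  "min_open X x = \<Inter>{U. openin X U \<and> x \<in> U}"

definition pt_le :: "'a topology \<Rightarrow> 'a \<Rightarrow> 'a \<Rightarrow> bool" where
  "pt_le X x y \<longleftrightarrow> x \<in> topspace X \<and> y \<in> topspace X \<and> min_open X x \<subseteq> min_open X y"

definition down_pts :: "'a topology \<Rightarrow> 'a \<Rightarrow> 'a set" where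
  "down_pts X x = {z. pt_le X z x}"

definition up_pts :: "'a topology \<Rightarrow> 'a \<Rightarrow> 'a set" where
  "up_pts X x = {z. pt_le X x z}"

definition down_beat_point :: "'a topology \<Rightarrow> 'a \<Rightarrow> bool" where
  "down_beat_point X x \<longleftrightarrow> x \<in> topspace X \<and>
     (\<exists>m \<in> down_pts X x - {x}. \<forall>z \<in> down_pts X x - {x}. pt_le X z m)"

definition up_beat_point :: "'a topology \<Rightarrow> 'a \<Rightarrow> bool" where
  "up_beat_point X x \<longleftrightarrow> x \<in> topspace X \<and>
     (\<exists>m \<in> up_pts X x - {x}. \<forall>z \<in> up_pts X x - {x}. pt_le X m z)"

inductive dbp_retract :: "'a topology \<Rightarrow> 'a set \<Rightarrow> bool" for X where
  refl: "dbp_retract X (topspace X)"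
| remove: "dbp_retract X A \<Longrightarrow> down_beat_point (subtopology X A) x \<Longrightarrow> dbp_retract X (A - {x})"

inductive ubp_retract :: "'a topology \<Rightarrow> 'a set \<Rightarrow> bool" for X where
  refl: "ubp_retract X (topspace X)"
| remove: "ubp_retract X A \<Longrightarrow> up_beat_point (subtopology X A) x \<Longrightarrow> ubp_retract X (A - {x})"

definition retraction_onto :: "'a topology \<Rightarrow> 'a set \<Rightarrow> ('a \<Rightarrow> 'a) \<Rightarrow> bool" where
  "retraction_onto X A r \<longleftrightarrow> continuous_map X (subtopology X A) r \<and> (\<forall>a\<in>A. r a = a)"

text \<open>
  A bp-retract together with its corresponding retraction.  A subspace can be a dbp-retract and a
  ubp-retract at the same time, with two different retractions (the middle point of a three-element
  chain is both a down and an up beat point); either of them is then allowed as \<open>r\<close>.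
\<close>

definition bp_retraction :: "'a topology \<Rightarrow> 'a set \<Rightarrow> ('a \<Rightarrow> 'a) \<Rightarrow> bool" where
  "bp_retraction X A r \<longleftrightarrow> retraction_onto X A r \<and>
     ((dbp_retract X A \<and> (\<forall>x\<in>topspace X. pt_le X (r x) x)) \<or>
      (ubp_retract X A \<and> (\<forall>x\<in>topspace X. pt_le X x (r x))))"

definition mnl :: "'a topology \<Rightarrow> 'a set" where
  "mnl X = {x \<in> topspace X. \<forall>y. pt_le X y x \<longrightarrow> y = x}"

definition up_inter :: "'a topology \<Rightarrow> 'a set \<Rightarrow> 'a set" where
  "up_inter X B = (\<Inter>b\<in>B. up_pts X b)"

definition FF :: "'a topology \<Rightarrow> 'a set set" where
  "FF X = \<Union>{connected_components_of (subtopology X (up_inter X B)) | B.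
              B \<noteq> {} \<and> B \<subseteq> mnl X \<and> up_inter X B \<noteq> {}}"

definition FF_le :: "'a set \<Rightarrow> 'a set \<Rightarrow> bool" where
  "FF_le C D \<longleftrightarrow> D \<subseteq> C"

definition down_set_topology :: "'b set \<Rightarrow> ('b \<Rightarrow> 'b \<Rightarrow> bool) \<Rightarrow> 'b topology" where
  "down_set_topology S le = topology (\<lambda>U. U \<subseteq> S \<and> (\<forall>x\<in>U. \<forall>y\<in>S. le y x \<longrightarrow> y \<in> U))"

definition FF_space :: "'a topology \<Rightarrow> 'a set topology" where
  "FF_space X = down_set_topology (FF X) FF_le"

definition FF_map :: "'a topology \<Rightarrow> 'b topology \<Rightarrow> ('a \<Rightarrow> 'b) \<Rightarrow> 'a set \<Rightarrow> 'b set" where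
  "FF_map X Y f C = (THE D. D \<in> FF Y \<and> f ` C \<subseteq> D \<and> (\<forall>E\<in>FF Y. f ` C \<subseteq> E \<longrightarrow> FF_le E D))"

lemma openin_down_set_topology:
  "openin (down_set_topology S le) U \<longleftrightarrow> U \<subseteq> S \<and> (\<forall>x\<in>U. \<forall>y\<in>S. le y x \<longrightarrow> y \<in> U)"
proof -
  have "istopology (\<lambda>U. U \<subseteq> S \<and> (\<forall>x\<in>U. \<forall>y\<in>S. le y x \<longrightarrow> y \<in> U))"
    unfolding istopology_def by blast
  then show ?thesis
    by (simp add: down_set_topology_def topology_inverse')
qed

lemma topspace_down_set_topology: "topspace (down_set_topology S le) = S"
  unfolding topspace_def by (auto simp: openin_down_set_topology)

lemma openin_min_open:
  assumes "finite (topspace X)" "x \<in> topspace X"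
  shows "openin X (min_open X x)"
proof -
  have "finite {U. openin X U \<and> x \<in> U}"
    using finite_subset[of "{U. openin X U \<and> x \<in> U}" "Pow (topspace X)"] assms(1)
    by (auto dest: openin_subset)
  then show ?thesis
    unfolding min_open_def using assms(2) by (intro openin_Inter) auto
qed

lemma mem_min_open: "x \<in> min_open X x"
  by (simp add: min_open_def)

lemma min_open_subset: "openin X U \<Longrightarrow> x \<in> U \<Longrightarrow> min_open X x \<subseteq> U"
  by (auto simp: min_open_def)

lemma pt_le_iff_mem:
  assumes "finite (topspace X)" "y \<in> topspace X"
  shows "pt_le X x y \<longleftrightarrow> x \<in> min_open X y"
proof
  assume "pt_le X x y"
  then show "x \<in> min_open X y"
    using mem_min_open[of x X] by (auto simp: pt_le_def)
next
  assume *: "x \<in> min_open X y"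
  have op: "openin X (min_open X y)" by (rule openin_min_open[OF assms])
  show "pt_le X x y"
    using min_open_subset[OF op *] openin_subset[OF op] * assms(2) by (auto simp: pt_le_def)
qed

lemma down_pts_eq_min_open:
  assumes "finite (topspace X)" "x \<in> topspace X"
  shows "down_pts X x = min_open X x"
  unfolding down_pts_def pt_le_iff_mem[OF assms] by (rule Collect_mem_eq)

lemma pt_le_iff_openin:
  "pt_le X x y \<longleftrightarrow> x \<in> topspace X \<and> y \<in> topspace X \<and> (\<forall>U. openin X U \<and> y \<in> U \<longrightarrow> x \<in> U)"
proof -
  have "min_open X x \<subseteq> min_open X y \<longleftrightarrow> (\<forall>U. openin X U \<and> y \<in> U \<longrightarrow> x \<in> U)"
  proof
    assume "min_open X x \<subseteq> min_open X y"
    then show "\<forall>U. openin X U \<and> y \<in> U \<longrightarrow> x \<in> U"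
      using mem_min_open[of x X] min_open_subset[of X _ y] by (meson subsetD)
  next
    assume "\<forall>U. openin X U \<and> y \<in> U \<longrightarrow> x \<in> U"
    then show "min_open X x \<subseteq> min_open X y"
      unfolding min_open_def by (intro Inter_anti_mono) blast
  qed
  then show ?thesis by (simp add: pt_le_def)
qed

lemma pt_le_subtopology:
  "pt_le (subtopology X A) x y \<longleftrightarrow> pt_le X x y \<and> x \<in> A \<and> y \<in> A"
  unfolding pt_le_iff_openin by (auto simp: openin_subtopology)

lemma pt_le_continuous_map:
  assumes "continuous_map X Y f" "pt_le X x y"
  shows "pt_le Y (f x) (f y)"
proof -
  have xy: "x \<in> topspace X" "y \<in> topspace X" and *: "\<And>U. openin X U \<Longrightarrow> y \<in> U \<Longrightarrow> x \<in> U"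
    using assms(2) by (simp_all add: pt_le_iff_openin)
  have "f x \<in> topspace Y" "f y \<in> topspace Y"
    using assms(1) xy by (auto simp: continuous_map_def)
  moreover have "f x \<in> V" if "openin Y V" "f y \<in> V" for V
    using *[OF openin_continuous_map_preimage[OF assms(1) that(1)]] xy that(2) by simp
  ultimately show ?thesis by (simp add: pt_le_iff_openin)
qed

lemma pt_le_trans: "pt_le X x y \<Longrightarrow> pt_le X y z \<Longrightarrow> pt_le X x z"
  unfolding pt_le_def by blast

lemma pt_le_antisym: "t0_space X \<Longrightarrow> pt_le X x y \<Longrightarrow> pt_le X y x \<Longrightarrow> x = y"
  unfolding pt_le_iff_openin t0_space_def by metis

lemma mnl_below:
  assumes "finite (topspace X)" "t0_space X" "x \<in> topspace X"
  shows "\<exists>b \<in> mnl X. pt_le X b x"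
  using assms(3)
proof (induction "card (min_open X x)" arbitrary: x rule: less_induct)
  case less
  show ?case
  proof (cases "x \<in> mnl X")
    case True
    then show ?thesis using less.prems by (intro bexI[of _ x]) (simp_all add: pt_le_def)
  next
    case False
    then obtain y where y: "pt_le X y x" "y \<noteq> x" using less.prems unfolding mnl_def by blast
    then have "\<not> pt_le X x y" using pt_le_antisym[OF assms(2)] by metis
    with y have sub: "min_open X y \<subset> min_open X x" and yX: "y \<in> topspace X"
      by (auto simp: pt_le_def)
    have "finite (min_open X x)"
      using finite_subset[OF openin_subset[OF openin_min_open[OF assms(1) less.prems]] assms(1)] .
    then obtain b where "b \<in> mnl X" "pt_le X b y"
      using less.hyps[OF psubset_card_mono[OF _ sub] yX] by metis
    then show ?thesis using y(1) pt_le_trans by metis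
  qed
qed

text \<open>The maximum in \<^term>\<open>FF_map X Y f C\<close> exists.\<close>

lemma FF_map_greatest:
  assumes Y: "finite (topspace Y)" "t0_space Y" and f: "continuous_map X Y f" and C: "C \<in> FF X"
  shows "\<exists>!D. D \<in> FF Y \<and> f ` C \<subseteq> D \<and> (\<forall>E\<in>FF Y. f ` C \<subseteq> E \<longrightarrow> FF_le E D)"
proof -
  obtain B where B: "B \<noteq> {}" "B \<subseteq> mnl X"
    and CB: "C \<in> connected_components_of (subtopology X (up_inter X B))"
    using C unfolding FF_def by auto
  have conC: "connectedin X C" "C \<subseteq> up_inter X B"
    using connectedin_connected_components_of[OF CB] by (simp_all add: connectedin_subtopology)
  have neC: "C \<noteq> {}" using nonempty_connected_components_of[OF CB] .
  have con: "connectedin Y (f ` C)" using connectedin_continuous_map_image[OF f conC(1)] .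
  define B' where "B' = {b \<in> mnl Y. f ` C \<subseteq> up_pts Y b}"
  obtain b where b: "b \<in> B" using B(1) by blast
  then have "b \<in> topspace X" using B(2) by (auto simp: mnl_def)
  then have "f b \<in> topspace Y" using f by (auto simp: continuous_map_def)
  then obtain b' where b': "b' \<in> mnl Y" "pt_le Y b' (f b)" using mnl_below[OF Y] by metis
  have "f ` C \<subseteq> up_pts Y b'"
  proof
    fix y assume "y \<in> f ` C"
    then obtain c where c: "c \<in> C" "y = f c" by blast
    then have "pt_le X b c" using conC(2) b by (auto simp: up_inter_def up_pts_def)
    then show "y \<in> up_pts Y b'"
      using pt_le_trans[OF b'(2) pt_le_continuous_map[OF f]] c(2) by (simp add: up_pts_def)
  qed
  then have "b' \<in> B'" using b' by (auto simp: B'_def)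
  then have B'ne: "B' \<noteq> {}" "B' \<subseteq> mnl Y" by (auto simp: B'_def)
  have sub: "f ` C \<subseteq> up_inter Y B'" by (auto simp: B'_def up_inter_def)
  then have ne: "up_inter Y B' \<noteq> {}" using neC by auto
  have con': "connectedin (subtopology Y (up_inter Y B')) (f ` C)"
    using con sub by (simp add: connectedin_subtopology)
  have ne_top: "subtopology Y (up_inter Y B') \<noteq> trivial_topology"
    using neC connectedin_subset_topspace[OF con'] unfolding null_topspace_iff_trivial[symmetric] by blast
  obtain D where D: "D \<in> connected_components_of (subtopology Y (up_inter Y B'))" "f ` C \<subseteq> D"
    using exists_connected_component_of_superset[OF con' ne_top] by blast
  have DF: "D \<in> FF Y" using D(1) B'ne ne unfolding FF_def by (intro UnionI[OF CollectI]) auto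
  have least: "D \<subseteq> E" if E: "E \<in> FF Y" "f ` C \<subseteq> E" for E
  proof -
    obtain B2 where B2: "B2 \<noteq> {}" "B2 \<subseteq> mnl Y"
      and EB: "E \<in> connected_components_of (subtopology Y (up_inter Y B2))"
      using E(1) unfolding FF_def by auto
    have "E \<subseteq> up_inter Y B2" using connected_components_of_subset[OF EB] by auto
    then have "B2 \<subseteq> B'" using E(2) B2(2) unfolding B'_def up_inter_def by auto
    then have "up_inter Y B' \<subseteq> up_inter Y B2" by (auto simp: up_inter_def)
    then have "connectedin (subtopology Y (up_inter Y B2)) D"
      using connectedin_connected_components_of[OF D(1)] by (auto simp: connectedin_subtopology)
    moreover have "\<not> disjnt E D" using D(2) E(2) neC by (auto simp: disjnt_def)
    ultimately show ?thesis using connected_components_of_maximal[OF EB] by blast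
  qed
  show ?thesis
  proof (rule ex1I[of _ D])
    fix D' assume "D' \<in> FF Y \<and> f ` C \<subseteq> D' \<and> (\<forall>E\<in>FF Y. f ` C \<subseteq> E \<longrightarrow> FF_le E D')"
    then have "D' \<subseteq> D" "D \<subseteq> D'" using DF D(2) least[of D'] by (simp_all add: FF_le_def)
    then show "D' = D" by (rule equalityI)
  qed (use DF D(2) least in \<open>simp add: FF_le_def\<close>)
qed

end

theory Submission
  imports Defs
begin

text \<open>
  The point is that \<^term>\<open>FF_map\<close> for the retraction \<open>r\<close> is just \<open>C \<mapsto> C \<inter> A\<close>, as soon as \<open>A\<close> contains
  the minimal points of \<open>X\<close>.  In that case \<open>X\<close> and \<open>A\<close> have the same minimal points, and \<open>r\<close> fixes them;
  being monotone, \<open>r\<close> maps each intersection of up-sets \<open>F\<^sub>B\<close> onto \<open>F\<^sub>B \<inter> A\<close>.  Comparable points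
  lie in the same component and \<open>r x\<close> is comparable with \<open>x\<close>, so \<open>r\<close> moves no point out of its component:
  \<open>r(C) = C \<inter> A\<close>.  This image is connected, and it is a whole component of \<open>F\<^sub>B \<inter> A\<close>
  because a connected subset of \<open>F\<^sub>B \<inter> A\<close> meeting \<open>C\<close> stays in \<open>C\<close>
  (\<open>retraction_image_component\<close>).  In the other direction, the map induced by the inclusion sends
  \<open>D\<close> to the smallest member of \<^term>\<open>FF X\<close> containing \<open>D\<close>.  Hence going from \<open>C\<close> to \<open>C \<inter> A\<close>
  and back yields a subset of \<open>C\<close>, which is (c), and going from \<open>D\<close> to \<open>X\<close> and back yields \<open>D\<close>.

  For (b), a down beat point is never minimal, so a dbp-retract does contain the minimal points.
  Moreover every \<open>x\<close> has a greatest point of \<open>A\<close> below it (\<open>dbp_retract_greatest_below\<close>).  For \<open>x \<in> C\<close>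
  that point still lies in \<open>C\<close>, so \<open>C\<close> is contained in the up-closure of \<open>C \<inter> A\<close>; since members of
  \<^term>\<open>FF X\<close> are up-closed, \<open>C \<inter> A \<subseteq> E\<close> already forces \<open>C \<subseteq> E\<close>.  So \<open>C \<mapsto> C \<inter> A\<close> is an isomorphism
  of posets.  This argument concerns \<open>A\<close> alone, so it also covers the case in which \<open>A\<close> is a
  retract of both kinds and \<open>r\<close> is the retraction lying above the identity.
\<close>

section \<open>Components of intersections of up-sets\<close>

lemma connectedin_comparable_pair:
  assumes "pt_le X x y"
  shows "connectedin X {x, y}"
proof -
  have "x \<in> topspace X" "y \<in> topspace X" "\<And>U. openin X U \<Longrightarrow> y \<in> U \<Longrightarrow> x \<in> U"
    using assms by (auto simp: pt_le_iff_openin)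
  then show ?thesis unfolding connectedin by blast
qed

lemma component_closed_under_comparable:
  assumes C: "C \<in> connected_components_of (subtopology X S)" and x: "x \<in> C" and y: "y \<in> S"
    and cmp: "pt_le X x y \<or> pt_le X y x"
  shows "y \<in> C"
proof -
  have "x \<in> S" using connected_components_of_subset[OF C] x by auto
  moreover have "connectedin X {x, y}"
    using cmp connectedin_comparable_pair[of X x y] connectedin_comparable_pair[of X y x]
    by (auto simp: insert_commute)
  ultimately have "connectedin (subtopology X S) {x, y}"
    using y by (simp add: connectedin_subtopology)
  moreover have "\<not> disjnt C {x, y}" using x by auto
  ultimately show ?thesis using connected_components_of_maximal[OF C] by blast
qed

lemma FF_cases:
  assumes "C \<in> FF X"
  obtains B where "B \<noteq> {}" "B \<subseteq> mnl X"
    "C \<in> connected_components_of (subtopology X (up_inter X B))"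
  using assms unfolding FF_def by blast

lemma FF_intro:
  assumes "B \<noteq> {}" "B \<subseteq> mnl X" "C \<in> connected_components_of (subtopology X (up_inter X B))"
  shows "C \<in> FF X"
proof -
  have "C \<noteq> {}" "C \<subseteq> up_inter X B"
    using nonempty_connected_components_of[OF assms(3)] connected_components_of_subset[OF assms(3)]
    by auto
  then have "up_inter X B \<noteq> {}" by blast
  then show ?thesis using assms unfolding FF_def by blast
qed

lemma FF_up_closed:
  assumes "C \<in> FF X" "x \<in> C" "pt_le X x y"
  shows "y \<in> C"
proof -
  obtain B where C: "C \<in> connected_components_of (subtopology X (up_inter X B))"
    using FF_cases[OF assms(1)] by metis
  have "x \<in> up_inter X B" using connected_components_of_subset[OF C] assms(2) by auto
  then have "y \<in> up_inter X B"
    using assms(3) pt_le_trans[of X _ x y] by (auto simp: up_inter_def up_pts_def)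
  then show ?thesis using component_closed_under_comparable[OF C assms(2)] assms(3) by blast
qed

lemma FF_map_eqI:
  assumes "D \<in> FF Y" "f ` C \<subseteq> D" "\<And>E. E \<in> FF Y \<Longrightarrow> f ` C \<subseteq> E \<Longrightarrow> D \<subseteq> E"
  shows "FF_map X Y f C = D"
  unfolding FF_map_def using assms by (intro the_equality) (auto simp: FF_le_def)

section \<open>Subspaces containing the minimal points\<close>

lemma mnl_subtopology:
  assumes "finite (topspace X)" "t0_space X" "mnl X \<subseteq> A"
  shows "mnl (subtopology X A) = mnl X"
proof
  show "mnl (subtopology X A) \<subseteq> mnl X"
  proof
    fix x assume x: "x \<in> mnl (subtopology X A)"
    then have "x \<in> topspace X" "x \<in> A" by (auto simp: mnl_def)
    then obtain b where "b \<in> mnl X" "pt_le X b x" using mnl_below[OF assms(1,2)] by metis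
    moreover from this have "b = x"
      using x assms(3) \<open>x \<in> A\<close> by (auto simp: mnl_def pt_le_subtopology)
    ultimately show "x \<in> mnl X" by simp
  qed
  show "mnl X \<subseteq> mnl (subtopology X A)"
    using assms(3) by (auto simp: mnl_def pt_le_subtopology)
qed

lemma up_inter_subtopology:
  assumes "B \<noteq> {}" "B \<subseteq> A"
  shows "up_inter (subtopology X A) B = up_inter X B \<inter> A"
  using assms by (auto simp: up_inter_def up_pts_def pt_le_subtopology)

lemma up_inter_subtopology_mnl:
  assumes "mnl X \<subseteq> A" "B \<noteq> {}" "B \<subseteq> mnl X"
  shows "subtopology (subtopology X A) (up_inter (subtopology X A) B)
    = subtopology X (up_inter X B \<inter> A)"
  using up_inter_subtopology[of B A X] assms
  by (simp add: subtopology_subtopology Int_absorb1 inf.absorb2 Int_commute subset_trans)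

text \<open>
  The map \<open>r\<close> preserves \<open>F\<^sub>B\<close> because it is monotone and fixes \<open>B\<close>, and it preserves the component \<open>C\<close>
  because \<open>x\<close> and \<open>r x\<close> are comparable; so \<open>C \<inter> A\<close> is connected, being the image of \<open>C\<close>.  Allowing the
  direction of the comparison to vary from point to point treats retractions below and above the
  identity together.
\<close>

lemma retraction_image_component:
  assumes mA: "mnl X \<subseteq> A" and r: "retraction_onto X A r"
    and cmp: "\<And>x. x \<in> topspace X \<Longrightarrow> pt_le X (r x) x \<or> pt_le X x (r x)"
    and B: "B \<noteq> {}" "B \<subseteq> mnl X"
    and C: "C \<in> connected_components_of (subtopology X (up_inter X B))"
  shows "r ` C = C \<inter> A"
    and "C \<inter> A \<in> connected_components_of (subtopology X (up_inter X B \<inter> A))"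
proof -
  let ?S = "up_inter X B"
  have cont: "continuous_map X (subtopology X A) r" and fix_A: "\<And>a. a \<in> A \<Longrightarrow> r a = a"
    using r by (auto simp: retraction_onto_def)
  have contX: "continuous_map X X r" using cont continuous_map_into_fulltopology by blast
  have C_sub: "C \<subseteq> topspace X" "C \<subseteq> ?S" using connected_components_of_subset[OF C] by auto
  have r_in_A: "r x \<in> A" if "x \<in> topspace X" for x
    using continuous_map_image_subset_topspace[OF cont] that by auto
  have r_in_S: "r x \<in> ?S" if "x \<in> ?S" for x
    unfolding up_inter_def up_pts_def
  proof (intro INT_I CollectI)
    fix b assume b: "b \<in> B"
    then have "pt_le X (r b) (r x)"
      using that by (intro pt_le_continuous_map[OF contX]) (auto simp: up_inter_def up_pts_def)
    moreover have "r b = b" using b B(2) mA fix_A by blast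
    ultimately show "pt_le X b (r x)" by simp
  qed
  have r_in_C: "r x \<in> C" if "x \<in> C" for x
    using component_closed_under_comparable[OF C that r_in_S] cmp[of x] that C_sub by blast
  show im: "r ` C = C \<inter> A"
  proof
    show "r ` C \<subseteq> C \<inter> A" using r_in_C r_in_A C_sub by blast
    show "C \<inter> A \<subseteq> r ` C" using fix_A by force
  qed
  have "connectedin X C"
    using connectedin_connected_components_of[OF C] by (simp add: connectedin_subtopology)
  then have con: "connectedin X (C \<inter> A)"
    using connectedin_continuous_map_image[OF contX] im by metis
  have ne: "C \<inter> A \<noteq> {}" using im nonempty_connected_components_of[OF C] by blast
  have con': "connectedin (subtopology X (?S \<inter> A)) (C \<inter> A)"
    using con C_sub by (auto simp: connectedin_subtopology)
  have "subtopology X (?S \<inter> A) \<noteq> trivial_topology"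
    using ne connectedin_subset_topspace[OF con']
    unfolding null_topspace_iff_trivial[symmetric] by blast
  then obtain D where D: "D \<in> connected_components_of (subtopology X (?S \<inter> A))" "C \<inter> A \<subseteq> D"
    using exists_connected_component_of_superset[OF con'] by blast
  \<comment> \<open>The component \<open>D\<close> is connected in \<open>F\<^sub>B\<close> as well and meets \<open>C\<close>, so it cannot leave \<open>C\<close>.\<close>
  have "connectedin (subtopology X ?S) D" "D \<subseteq> A"
    using connectedin_connected_components_of[OF D(1)] by (auto simp: connectedin_subtopology)
  moreover have "\<not> disjnt C D" using ne D(2) by (auto simp: disjnt_def)
  ultimately have "D \<subseteq> C \<inter> A" using connected_components_of_maximal[OF C] by blast
  then have "D = C \<inter> A" using D(2) by (rule equalityI)
  then show "C \<inter> A \<in> connected_components_of (subtopology X (?S \<inter> A))" using D(1) by simp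
qed

section \<open>The maps induced by the retraction and the inclusion\<close>

lemma FF_retraction_image:
  assumes "finite (topspace X)" "t0_space X" and mA: "mnl X \<subseteq> A" and r: "retraction_onto X A r"
    and cmp: "\<And>x. x \<in> topspace X \<Longrightarrow> pt_le X (r x) x \<or> pt_le X x (r x)"
    and C: "C \<in> FF X"
  shows "r ` C = C \<inter> A" "C \<inter> A \<in> FF (subtopology X A)"
    and "FF_map X (subtopology X A) r C = C \<inter> A"
proof -
  obtain B where B: "B \<noteq> {}" "B \<subseteq> mnl X"
    "C \<in> connected_components_of (subtopology X (up_inter X B))"
    using FF_cases[OF C] .
  note comp = retraction_image_component[OF mA r cmp B]
  show im: "r ` C = C \<inter> A" using comp(1) by blast
  show mem: "C \<inter> A \<in> FF (subtopology X A)"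
    using FF_intro[of B "subtopology X A" "C \<inter> A"] B comp(2) mnl_subtopology[OF assms(1,2) mA]
      up_inter_subtopology_mnl[OF mA B(1,2)] by simp
  show "FF_map X (subtopology X A) r C = C \<inter> A" using im mem by (intro FF_map_eqI) auto
qed

lemma FF_inclusion_least:
  assumes "finite (topspace X)" "t0_space X" "D \<in> FF (subtopology X A)"
  shows "FF_map (subtopology X A) X id D \<in> FF X" "D \<subseteq> FF_map (subtopology X A) X id D"
    and "\<And>E. E \<in> FF X \<Longrightarrow> D \<subseteq> E \<Longrightarrow> FF_map (subtopology X A) X id D \<subseteq> E"
proof -
  have "continuous_map (subtopology X A) X id"
    using continuous_map_from_subtopology[OF continuous_map_id] .
  from theI'[OF FF_map_greatest[OF assms(1,2) this assms(3)]]
  show "FF_map (subtopology X A) X id D \<in> FF X" "D \<subseteq> FF_map (subtopology X A) X id D"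
    "\<And>E. E \<in> FF X \<Longrightarrow> D \<subseteq> E \<Longrightarrow> FF_map (subtopology X A) X id D \<subseteq> E"
    by (auto simp: FF_map_def FF_le_def)
qed

text \<open>
  A component \<open>D\<close> of \<open>F\<^sub>B \<inter> A\<close> is the trace of the component \<open>C\<close> of \<open>F\<^sub>B\<close> around it, since that trace is
  itself a component.  The least member of \<^term>\<open>FF X\<close> containing \<open>D\<close> lies between \<open>D\<close> and \<open>C\<close>, so it has
  the same trace.
\<close>

lemma FF_inclusion_trace:
  assumes fin: "finite (topspace X)" and t0: "t0_space X"
    and mA: "mnl X \<subseteq> A" and r: "retraction_onto X A r"
    and cmp: "\<And>x. x \<in> topspace X \<Longrightarrow> pt_le X (r x) x \<or> pt_le X x (r x)"
    and D: "D \<in> FF (subtopology X A)"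
  shows "FF_map (subtopology X A) X id D \<inter> A = D"
proof -
  obtain B where B: "B \<noteq> {}" "B \<subseteq> mnl X"
    and D_comp: "D \<in> connected_components_of (subtopology X (up_inter X B \<inter> A))"
    using FF_cases[OF D] mnl_subtopology[OF fin t0 mA] up_inter_subtopology_mnl[OF mA] by metis
  have con: "connectedin (subtopology X (up_inter X B)) D" and DA: "D \<subseteq> A"
    using connectedin_connected_components_of[OF D_comp] by (auto simp: connectedin_subtopology)
  have neD: "D \<noteq> {}" using nonempty_connected_components_of[OF D_comp] .
  have "subtopology X (up_inter X B) \<noteq> trivial_topology"
    using neD connectedin_subset_topspace[OF con]
    unfolding null_topspace_iff_trivial[symmetric] by blast
  then obtain C where C: "C \<in> connected_components_of (subtopology X (up_inter X B))" "D \<subseteq> C"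
    using exists_connected_component_of_superset[OF con] by blast
  have "C \<inter> A \<in> connected_components_of (subtopology X (up_inter X B \<inter> A))"
    using retraction_image_component(2)[OF mA r cmp B C(1)] .
  moreover have "\<not> disjnt D (C \<inter> A)" using neD C(2) DA by (auto simp: disjnt_def)
  ultimately have "C \<inter> A \<subseteq> D"
    using connected_components_of_maximal[OF D_comp] connectedin_connected_components_of by metis
  moreover have "FF_map (subtopology X A) X id D \<subseteq> C"
    using FF_inclusion_least(3)[OF fin t0 D FF_intro[OF B C(1)] C(2)] .
  ultimately show ?thesis using FF_inclusion_least(2)[OF fin t0 D] DA by blast
qed

section \<open>Retracts by removal of down beat points\<close>

lemma dbp_retract_contains_mnl:
  assumes "dbp_retract X A"
  shows "mnl X \<subseteq> A"
  using assms
proof induction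
  case refl
  then show ?case by (auto simp: mnl_def)
next
  case (remove A x)
  then obtain m where "pt_le X m x" "m \<noteq> x"
    by (auto simp: down_beat_point_def down_pts_def pt_le_subtopology)
  then have "x \<notin> mnl X" by (auto simp: mnl_def)
  then show ?case using remove.IH by blast
qed

text \<open>
  The greatest point of \<open>A\<close> below \<open>x\<close> is the value at \<open>x\<close> of the retraction below the identity.
  When it is the point being removed, the maximum of the points strictly below it takes its place.
\<close>

lemma dbp_retract_greatest_below:
  assumes "dbp_retract X A" "x \<in> topspace X"
  shows "\<exists>m\<in>A. pt_le X m x \<and> (\<forall>a\<in>A. pt_le X a x \<longrightarrow> pt_le X a m)"
  using assms(1)
proof induction
  case refl
  have "pt_le X x x" using assms(2) by (simp add: pt_le_def)
  then show ?case using assms(2) by blast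
next
  case (remove A y)
  obtain m where m: "m \<in> A" "pt_le X m x" "\<And>a. a \<in> A \<Longrightarrow> pt_le X a x \<Longrightarrow> pt_le X a m"
    using remove.IH by blast
  obtain n where n: "n \<in> A" "n \<noteq> y" "pt_le X n y"
    "\<And>a. a \<in> A \<Longrightarrow> a \<noteq> y \<Longrightarrow> pt_le X a y \<Longrightarrow> pt_le X a n"
    using remove.hyps(2)
    by (fastforce simp: down_beat_point_def down_pts_def pt_le_subtopology)
  show ?case
  proof (cases "m = y")
    case True
    then have "pt_le X n x" using pt_le_trans[OF n(3)] m(2) by simp
    then show ?thesis using True m(3) n by (intro bexI[of _ n]) auto
  next
    case False
    then show ?thesis using m by (intro bexI[of _ m]) auto
  qed
qed

text \<open>
  Each \<open>x \<in> C\<close> lies above a point of \<open>C \<inter> A\<close>, namely the greatest point of \<open>A\<close> below \<open>x\<close>: it is above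
  all \<open>b \<in> B\<close>, as these belong to \<open>A\<close> and are below \<open>x\<close>.  This turns \<open>C \<mapsto> C \<inter> A\<close> into an order embedding.
\<close>

lemma dbp_retract_FF_subset:
  assumes A: "dbp_retract X A" and C: "C \<in> FF X" and E: "E \<in> FF X" and sub: "C \<inter> A \<subseteq> E"
  shows "C \<subseteq> E"
proof
  fix x assume x: "x \<in> C"
  obtain B where B: "B \<noteq> {}" "B \<subseteq> mnl X"
    and C_comp: "C \<in> connected_components_of (subtopology X (up_inter X B))"
    using FF_cases[OF C] .
  have xS: "x \<in> topspace X" "x \<in> up_inter X B"
    using connected_components_of_subset[OF C_comp] x by auto
  obtain m where m: "m \<in> A" "pt_le X m x" "\<And>a. a \<in> A \<Longrightarrow> pt_le X a x \<Longrightarrow> pt_le X a m"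
    using dbp_retract_greatest_below[OF A xS(1)] by blast
  have "m \<in> up_inter X B"
    using m(3) xS(2) B(2) dbp_retract_contains_mnl[OF A] by (auto simp: up_inter_def up_pts_def)
  then have "m \<in> C" using component_closed_under_comparable[OF C_comp x] m(2) by blast
  then show "x \<in> E" using FF_up_closed[OF E _ m(2)] sub m(1) by blast
qed

lemma homeomorphic_map_down_set_topology:
  assumes bij: "bij_betw f S T"
    and ord: "\<And>x y. x \<in> S \<Longrightarrow> y \<in> S \<Longrightarrow> le' (f x) (f y) \<longleftrightarrow> le x y"
  shows "homeomorphic_map (down_set_topology S le) (down_set_topology T le') f"
proof (rule bijective_open_imp_homeomorphic_map)
  have im: "f ` S = T" and inj: "inj_on f S" using bij by (auto simp: bij_betw_def)
  show "continuous_map (down_set_topology S le) (down_set_topology T le') f"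
    unfolding continuous_map_def topspace_down_set_topology openin_down_set_topology
    using im ord by auto
  show "open_map (down_set_topology S le) (down_set_topology T le') f"
    unfolding open_map_def openin_down_set_topology using im ord by fast
  show "f ` topspace (down_set_topology S le) = topspace (down_set_topology T le')"
    "inj_on f (topspace (down_set_topology S le))"
    using im inj by (simp_all add: topspace_down_set_topology)
qed

section \<open>The induced maps of a bp-retraction\<close>

theorem proposition6p4:
  fixes X :: "'a topology" and A :: "'a set" and r :: "'a \<Rightarrow> 'a"
  assumes "finite (topspace X)" and "t0_space X"
    and "bp_retraction X A r"
  shows "(mnl X \<subseteq> A \<longrightarrow>
            (\<forall>C \<in> FF X. FF_map X (subtopology X A) r C = r ` C) \<and>
            (\<forall>C \<in> FF (subtopology X A).
               FF_map X (subtopology X A) r (FF_map (subtopology X A) X id C) = C))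
       \<and> (dbp_retract X A \<longrightarrow>
            homeomorphic_map (FF_space X) (FF_space (subtopology X A))
              (FF_map X (subtopology X A) r))
       \<and> (mnl X \<subseteq> A \<and> ubp_retract X A \<longrightarrow>
            (\<forall>C \<in> FF X. FF_le C (FF_map (subtopology X A) X id (FF_map X (subtopology X A) r C))))"
proof -
  let ?A = "subtopology X A"
  let ?R = "FF_map X ?A r" and ?I = "FF_map ?A X id"
  have cmp: "pt_le X (r x) x \<or> pt_le X x (r x)" if "x \<in> topspace X" for x
    using assms(3) that by (auto simp: bp_retraction_def)
  have r: "retraction_onto X A r" using assms(3) by (simp add: bp_retraction_def)
  note R = FF_retraction_image[OF assms(1,2) _ r cmp]
  note I = FF_inclusion_least[OF assms(1,2)]
  have RI: "?R (?I D) = D" if "mnl X \<subseteq> A" "D \<in> FF ?A" for D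
    using R(3)[OF that(1) _ I(1)] FF_inclusion_trace[OF assms(1,2) that(1) r cmp that(2)] that(2)
    by simp
  have a: "(\<forall>C\<in>FF X. ?R C = r ` C) \<and> (\<forall>D\<in>FF ?A. ?R (?I D) = D)" if "mnl X \<subseteq> A"
    using R(1,3)[OF that] RI[OF that] by simp
  have b: "homeomorphic_map (FF_space X) (FF_space ?A) ?R" if dbp: "dbp_retract X A"
    unfolding FF_space_def
  proof (rule homeomorphic_map_down_set_topology)
    have mA: "mnl X \<subseteq> A" using dbp_retract_contains_mnl[OF dbp] .
    show ord: "FF_le (?R C) (?R E) \<longleftrightarrow> FF_le C E" if "C \<in> FF X" "E \<in> FF X" for C E
      using dbp_retract_FF_subset[OF dbp that(2,1)] R(3)[OF mA] that by (auto simp: FF_le_def)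
    show "bij_betw ?R (FF X) (FF ?A)"
      unfolding bij_betw_def
    proof
      show "inj_on ?R (FF X)"
        using ord by (intro inj_onI) (metis FF_le_def subset_antisym subset_refl)
      show "?R ` FF X = FF ?A"
      proof
        show "?R ` FF X \<subseteq> FF ?A" using R(2,3)[OF mA] by auto
        show "FF ?A \<subseteq> ?R ` FF X" using RI[OF mA] I(1) by (metis image_eqI subsetI)
      qed
    qed
  qed
  have c: "FF_le C (?I (?R C))" if "mnl X \<subseteq> A" "C \<in> FF X" for C
    using I(3)[OF R(2)[OF that(1) _ that(2)] that(2)] R(3)[OF that(1) _ that(2)]
    by (simp add: FF_le_def)
  from a b c show ?thesis by blast
qed

end
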